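(* Let $n>m\geq 1$ and $h\geq 1$. The modal logics of each of the classes $\mathcal{F}(m,n,h)$, $\mathcal{F}_*(m,n)$, $\mathcal{G}(m,h)$, $\mathcal{G}_*(m)$ have the finite model property.
   Context: Modal formulas are built from variables $p_1,p_2,\dots$, constants $\bot,\top$, Boolean connectives and a unary connective $\Diamond$. A frame is $(W,R)$ with $W\neq\emptyset$, $R\subseteq W\times W$; a model is a frame with a valuation $\theta$ assigning subsets of $W$ to variables; truth is defined as usual with $M,w\models\Diamond\varphi$ iff there is $v$ with $wRv$ and $M,v\models\varphi$. A formula is valid in a frame if it is true at every point of every model over it; $\mathrm{Log}\,\mathcal{C}$ is the set of formulas valid in all frames of the class $\mathcal{C}$. A logic has the finite model property (is finitely approximable) if it equals $\mathrm{Log}$ of some class of finite frames. $R^0$ is the identity, $R^{i+1}=R^i\circ R$, $R^*=\bigcup_{i\ge0}R^i$. An $(m,n)$-frame is a frame with $R^n\subseteq R^m$; $\mathcal{F}(m,n)$ is the class of all $(m,n)$-frames. A frame is $m$-transitive if $R^*=\bigcup_{0\le i\le m}R^i$; $\mathcal{G}(m)$ is the class of $m$-transitive frames. Clusters are the classes of $x\sim_R y\iff (xR^*y$ and $yR^*x)$; the skeleton is the partial order on clusters with $[x]\le[y]$ iff $xR^*y$; the height of a frame is the maximal cardinality of a chain in its skeleton. $\mathcal{F}(m,n,h)$ (resp. $\mathcal{G}(m,h)$) consists of frames in $\mathcal{F}(m,n)$ (resp. $\mathcal{G}(m)$) of height at most $h$; $\mathcal{F}_*(m,n)$ (resp. $\mathcal{G}_*(m)$)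 consists of frames in $\mathcal{F}(m,n)$ (resp. $\mathcal{G}(m)$) of finite height. *)

theory Defs
  imports Main "HOL-Library.Extended_Nat"
begin

datatype fm =
    Var nat
  | Bot
  | Top
  | Neg fm
  | And fm fm
  | Or fm fm
  | Imp fm fm
  | Dia fm

text \<open>
  A frame carries its own set of worlds, so that the frames over a type represent all
  frames of at most the cardinality of that type, not just those whose worlds exhaust it.
\<close>

datatype 'w frame = Frame (worlds: "'w set") (acc: "('w \<times> 'w) set")

definition is_frame :: "'w frame \<Rightarrow> bool" where
  "is_frame F \<longleftrightarrow> worlds F \<noteq> {} \<and> acc F \<subseteq> worlds F \<times> worlds F"

definition valuation :: "'w frame \<Rightarrow> (nat \<Rightarrow> 'w set) \<Rightarrow> bool" where
  "valuation F \<theta> \<longleftrightarrow> (\<forall>p. \<theta> p \<subseteq> worlds F)"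

primrec holds :: "'w frame \<Rightarrow> (nat \<Rightarrow> 'w set) \<Rightarrow> 'w \<Rightarrow> fm \<Rightarrow> bool" where
  "holds F \<theta> w (Var p) \<longleftrightarrow> w \<in> \<theta> p"
| "holds F \<theta> w Bot \<longleftrightarrow> False"
| "holds F \<theta> w Top \<longleftrightarrow> True"
| "holds F \<theta> w (Neg \<phi>) \<longleftrightarrow> \<not> holds F \<theta> w \<phi>"
| "holds F \<theta> w (And \<phi> \<psi>) \<longleftrightarrow> holds F \<theta> w \<phi> \<and> holds F \<theta> w \<psi>"
| "holds F \<theta> w (Or \<phi> \<psi>) \<longleftrightarrow> holds F \<theta> w \<phi> \<or> holds F \<theta> w \<psi>"
| "holds F \<theta> w (Imp \<phi> \<psi>) \<longleftrightarrow> (holds F \<theta> w \<phi> \<longrightarrow> holds F \<theta> w \<psi>)"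
| "holds F \<theta> w (Dia \<phi>) \<longleftrightarrow> (\<exists>v. (w, v) \<in> acc F \<and> holds F \<theta> v \<phi>)"

definition valid_in :: "'w frame \<Rightarrow> fm \<Rightarrow> bool" where
  "valid_in F \<phi> \<longleftrightarrow> (\<forall>\<theta>. valuation F \<theta> \<longrightarrow> (\<forall>w\<in>worlds F. holds F \<theta> w \<phi>))"

definition Log :: "'w frame set \<Rightarrow> fm set" where
  "Log C = {\<phi>. \<forall>F\<in>C. valid_in F \<phi>}"

text \<open>
  The finite frames are drawn from the type \<^typ>\<open>nat\<close>. This is no restriction, since every
  finite frame is isomorphic to one of these: see \<open>finite_frame_nat_copy\<close> below.
\<close>

definition has_fmp :: "fm set \<Rightarrow> bool" where
  "has_fmp L \<longleftrightarrow>
     (\<exists>K :: nat frame set. (\<forall>F\<in>K. is_frame F \<and> finite (worlds F)) \<and> L = Log K)"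

definition copy_frame :: "('w \<Rightarrow> 'v) \<Rightarrow> 'w frame \<Rightarrow> 'v frame" where
  "copy_frame f F = Frame (f ` worlds F) (map_prod f f ` acc F)"

lemma holds_copy_frame:
  assumes "is_frame F" "inj_on f (worlds F)" "\<And>p. \<theta> p \<subseteq> worlds F" "w \<in> worlds F"
  shows "holds (copy_frame f F) (\<lambda>p. f ` \<theta> p) (f w) \<phi> \<longleftrightarrow> holds F \<theta> w \<phi>"
  using assms(4)
proof (induction \<phi> arbitrary: w)
  case (Var p)
  then show ?case using assms(2,3) by (auto simp: inj_on_image_mem_iff)
next
  case (Dia \<phi>)
  have sub: "acc F \<subseteq> worlds F \<times> worlds F" using assms(1) by (simp add: is_frame_def)
  have "(f w, v) \<in> acc (copy_frame f F) \<longleftrightarrow> (\<exists>u. v = f u \<and> (w, u) \<in> acc F)" for v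
  proof
    assume "(f w, v) \<in> acc (copy_frame f F)"
    then obtain x u where xu: "(x, u) \<in> acc F" "f w = f x" "v = f u"
      by (auto simp: copy_frame_def)
    then have "w = x" using sub Dia.prems assms(2) by (auto simp: inj_on_def)
    then show "\<exists>u. v = f u \<and> (w, u) \<in> acc F" using xu by blast
  next
    assume "\<exists>u. v = f u \<and> (w, u) \<in> acc F"
    then show "(f w, v) \<in> acc (copy_frame f F)" by (auto simp: copy_frame_def)
  qed
  then have "holds (copy_frame f F) (\<lambda>p. f ` \<theta> p) (f w) (Dia \<phi>) \<longleftrightarrow>
      (\<exists>u. (w, u) \<in> acc F \<and> holds (copy_frame f F) (\<lambda>p. f ` \<theta> p) (f u) \<phi>)"
    by (simp only: holds.simps) blast
  also have "\<dots> \<longleftrightarrow> (\<exists>u. (w, u) \<in> acc F \<and> holds F \<theta> u \<phi>)"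
    using Dia.IH sub by blast
  finally show ?case by simp
qed auto

lemma valid_copy_frame:
  assumes "is_frame F" "inj_on f (worlds F)"
  shows "valid_in (copy_frame f F) \<phi> \<longleftrightarrow> valid_in F \<phi>"
proof
  assume L: "valid_in (copy_frame f F) \<phi>"
  show "valid_in F \<phi>" unfolding valid_in_def
  proof (intro allI impI ballI)
    fix \<theta> w assume v: "valuation F \<theta>" and w: "w \<in> worlds F"
    have "valuation (copy_frame f F) (\<lambda>p. f ` \<theta> p)"
      using v by (auto simp: valuation_def copy_frame_def)
    then have "holds (copy_frame f F) (\<lambda>p. f ` \<theta> p) (f w) \<phi>"
      using L w by (auto simp: valid_in_def copy_frame_def)
    then show "holds F \<theta> w \<phi>"
      using holds_copy_frame[OF assms] v w by (auto simp: valuation_def)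
  qed
next
  assume R: "valid_in F \<phi>"
  show "valid_in (copy_frame f F) \<phi>" unfolding valid_in_def
  proof (intro allI impI ballI)
    fix \<eta> y assume v: "valuation (copy_frame f F) \<eta>" and y: "y \<in> worlds (copy_frame f F)"
    define \<theta> where "\<theta> p = {w \<in> worlds F. f w \<in> \<eta> p}" for p
    have "\<eta> p \<subseteq> f ` worlds F" for p
      using v by (simp add: valuation_def copy_frame_def)
    then have \<eta>: "\<eta> = (\<lambda>p. f ` \<theta> p)"
      unfolding \<theta>_def fun_eq_iff set_eq_iff by blast
    have \<theta>: "\<theta> p \<subseteq> worlds F" for p by (auto simp: \<theta>_def)
    obtain w where w: "w \<in> worlds F" "y = f w" using y by (auto simp: copy_frame_def)
    have "holds F \<theta> w \<phi>" using R \<theta> w by (simp add: valid_in_def valuation_def)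
    then show "holds (copy_frame f F) \<eta> y \<phi>"
      using holds_copy_frame[OF assms \<theta> w(1)] \<eta> w by simp
  qed
qed

lemma finite_frame_nat_copy:
  fixes F :: "'w frame"
  assumes "is_frame F" "finite (worlds F)"
  shows "\<exists>f :: 'w \<Rightarrow> nat. inj_on f (worlds F) \<and> is_frame (copy_frame f F)
           \<and> finite (worlds (copy_frame f F))
           \<and> (\<forall>\<phi>. valid_in (copy_frame f F) \<phi> \<longleftrightarrow> valid_in F \<phi>)"
proof -
  obtain f :: "'w \<Rightarrow> nat" where f: "inj_on f (worlds F)"
    using finite_imp_inj_to_nat_seg[OF assms(2)] by blast
  have "is_frame (copy_frame f F)"
    using assms(1) by (auto simp: is_frame_def copy_frame_def)
  moreover have "finite (worlds (copy_frame f F))"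
    using assms(2) by (simp add: copy_frame_def)
  ultimately show ?thesis using f valid_copy_frame[OF assms(1) f] by blast
qed

text \<open>
  Here and below, \<open>R ^^ 0\<close> and \<open>R\<^sup>*\<close> contain the identity on the whole type rather than on the
  worlds of the frame only. In the definition of clusters and of the skeleton this is
  corrected by restricting to worlds; in the definition of \<open>m\<close>-transitivity
  the additional pairs occur on both sides of the equation.
\<close>

definition cluster_rel :: "'w frame \<Rightarrow> ('w \<times> 'w) set" where
  "cluster_rel F = {(x, y). x \<in> worlds F \<and> y \<in> worlds F
                      \<and> (x, y) \<in> (acc F)\<^sup>* \<and> (y, x) \<in> (acc F)\<^sup>*}"

definition clusters :: "'w frame \<Rightarrow> 'w set set" where
  "clusters F = worlds F // cluster_rel F"

definition skeleton :: "'w frame \<Rightarrow> ('w set \<times> 'w set) set" where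
  "skeleton F = {(cluster_rel F `` {x}, cluster_rel F `` {y}) | x y.
                   x \<in> worlds F \<and> y \<in> worlds F \<and> (x, y) \<in> (acc F)\<^sup>*}"

lemma equiv_cluster_rel: "equiv (worlds F) (cluster_rel F)"
  by (rule equivI) (auto simp: cluster_rel_def refl_on_def sym_def trans_def)

lemma skeleton_iff:
  assumes "x \<in> worlds F" "y \<in> worlds F"
  shows "(cluster_rel F `` {x}, cluster_rel F `` {y}) \<in> skeleton F \<longleftrightarrow> (x, y) \<in> (acc F)\<^sup>*"
proof
  assume "(cluster_rel F `` {x}, cluster_rel F `` {y}) \<in> skeleton F"
  then obtain x' y' where *: "cluster_rel F `` {x} = cluster_rel F `` {x'}"
      "cluster_rel F `` {y} = cluster_rel F `` {y'}"
      "x' \<in> worlds F" "y' \<in> worlds F" "(x', y') \<in> (acc F)\<^sup>*"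
    by (auto simp: skeleton_def)
  have "(x, x') \<in> cluster_rel F" "(y, y') \<in> cluster_rel F"
    using eq_equiv_class_iff[OF equiv_cluster_rel assms(1) *(3)]
      eq_equiv_class_iff[OF equiv_cluster_rel assms(2) *(4)] *(1,2) by simp_all
  then show "(x, y) \<in> (acc F)\<^sup>*"
    using *(5) by (auto simp: cluster_rel_def intro: rtrancl_trans)
qed (use assms in \<open>auto simp: skeleton_def\<close>)

lemma partial_order_on_skeleton: "partial_order_on (clusters F) (skeleton F)"
proof -
  have "refl_on (clusters F) (skeleton F)"
    by (auto simp: refl_on_def clusters_def quotient_def skeleton_iff)
  moreover have "skeleton F \<subseteq> clusters F \<times> clusters F"
    by (auto simp: skeleton_def clusters_def quotient_def)
  moreover have "trans (skeleton F)"
  proof (rule transI)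
    fix X Y Z assume a: "(X, Y) \<in> skeleton F" "(Y, Z) \<in> skeleton F"
    from a(1) obtain x y where 1: "X = cluster_rel F `` {x}" "Y = cluster_rel F `` {y}"
      "x \<in> worlds F" "y \<in> worlds F" "(x, y) \<in> (acc F)\<^sup>*" unfolding skeleton_def by blast
    from a(2) obtain z where 2: "Z = cluster_rel F `` {z}" "z \<in> worlds F"
      unfolding skeleton_def by blast
    have "(y, z) \<in> (acc F)\<^sup>*" using a(2) skeleton_iff[OF 1(4) 2(2)] 1(2) 2(1) by simp
    then have "(x, z) \<in> (acc F)\<^sup>*" using 1(5) by simp
    then show "(X, Z) \<in> skeleton F" using skeleton_iff[OF 1(3) 2(2)] 1(1) 2(1) by simp
  qed
  moreover have "antisym (skeleton F)"
  proof (rule antisymI)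
    fix X Y assume a: "(X, Y) \<in> skeleton F" "(Y, X) \<in> skeleton F"
    from a(1) obtain x y where 1: "X = cluster_rel F `` {x}" "Y = cluster_rel F `` {y}"
      "x \<in> worlds F" "y \<in> worlds F" "(x, y) \<in> (acc F)\<^sup>*" unfolding skeleton_def by blast
    have "(y, x) \<in> (acc F)\<^sup>*" using a(2) skeleton_iff[OF 1(4) 1(3)] 1(1,2) by simp
    then have "(x, y) \<in> cluster_rel F" using 1 by (simp add: cluster_rel_def)
    then show "X = Y" using equiv_class_eq[OF equiv_cluster_rel] 1(1,2) by simp
  qed
  ultimately show ?thesis
    by (simp add: partial_order_on_def preorder_on_def)
qed

definition height :: "'w frame \<Rightarrow> enat" where
  "height F = (SUP C \<in> Chains (skeleton F). if finite C then enat (card C) else \<infinity>)"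

definition mn_frames :: "nat \<Rightarrow> nat \<Rightarrow> 'w frame set" where
  "mn_frames m n = {F. is_frame F \<and> acc F ^^ n \<subseteq> acc F ^^ m}"

definition m_transitive_frames :: "nat \<Rightarrow> 'w frame set" where
  "m_transitive_frames m = {F. is_frame F \<and> (acc F)\<^sup>* = (\<Union>i\<le>m. acc F ^^ i)}"

definition mn_frames_height :: "nat \<Rightarrow> nat \<Rightarrow> nat \<Rightarrow> 'w frame set" where
  "mn_frames_height m n h = {F \<in> mn_frames m n. height F \<le> enat h}"

definition mn_frames_finite_height :: "nat \<Rightarrow> nat \<Rightarrow> 'w frame set" where
  "mn_frames_finite_height m n = {F \<in> mn_frames m n. height F < \<infinity>}"

definition m_transitive_frames_height :: "nat \<Rightarrow> nat \<Rightarrow> 'w frame set" where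
  "m_transitive_frames_height m h = {F \<in> m_transitive_frames m. height F \<le> enat h}"

definition m_transitive_frames_finite_height :: "nat \<Rightarrow> 'w frame set" where
  "m_transitive_frames_finite_height m = {F \<in> m_transitive_frames m. height F < \<infinity>}"

end

theory Submission
  imports Defs
begin

text \<open>
  Both steps of the argument replace a frame \<open>F\<close> by a minimal filtration \<open>copy_frame g F\<close>, where
  \<open>g\<close> need not be injective.

  First, every cluster is filtrated separately: points are identified if they
  satisfy the same subformulas of the given formula and are joined, in both directions, by paths
  whose length is divisible by \<open>p\<close>, where \<open>p = n - m\<close> for \<open>R\<^sup>n \<subseteq> R\<^sup>m\<close> and \<open>p = 1\<close> for
  \<open>m\<close>-transitivity. A path of length \<open>k\<close> in the quotient then lifts to a path of length
  \<open>k + p * j\<close> from any given preimage of its starting point, which is enough to preserve both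
  conditions as well as the height. There are at most \<open>p\<close> residues of path lengths, so the clusters
  of the quotient have bounded size.

  Second, in a frame of finite height with clusters of bounded size there are, by induction on the
  depth, only finitely many points up to bisimilarity, so the quotient by bisimilarity is finite.
\<close>

section \<open>Minimal filtrations\<close>

lemma relpow_worlds:
  assumes "is_frame F" "x \<in> worlds F" "(x, y) \<in> acc F ^^ k"
  shows "y \<in> worlds F"
  using assms by (cases k) (auto simp: is_frame_def)

lemma rtrancl_worlds:
  assumes "is_frame F" "x \<in> worlds F" "(x, y) \<in> (acc F)\<^sup>*"
  shows "y \<in> worlds F"
  using assms relpow_worlds by (metis rtrancl_imp_relpow)

lemma acc_worlds:
  assumes "is_frame F" "(x, y) \<in> acc F"
  shows "x \<in> worlds F" "y \<in> worlds F"
  using assms by (auto simp: is_frame_def)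

lemma worlds_copy_frame [simp]: "worlds (copy_frame g F) = g ` worlds F"
  by (simp add: copy_frame_def)

lemma acc_copy_frame [simp]: "acc (copy_frame g F) = map_prod g g ` acc F"
  by (simp add: copy_frame_def)

lemma is_frame_copy_frame: "is_frame F \<Longrightarrow> is_frame (copy_frame g F)"
  by (auto simp: is_frame_def)

lemma relpow_map_prod:
  "(x, y) \<in> R ^^ k \<Longrightarrow> (g x, g y) \<in> (map_prod g g ` R) ^^ k"
  by (induction k arbitrary: y) auto

lemma rtrancl_map_prod:
  "(x, y) \<in> R\<^sup>* \<Longrightarrow> (g x, g y) \<in> (map_prod g g ` R)\<^sup>*"
  by (metis rtrancl_imp_relpow relpow_imp_rtrancl relpow_map_prod)

section \<open>Subformulas and truth in minimal filtrations\<close>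

primrec subs :: "fm \<Rightarrow> fm set" where
  "subs (Var p) = {Var p}"
| "subs Bot = {Bot}"
| "subs Top = {Top}"
| "subs (Neg \<phi>) = insert (Neg \<phi>) (subs \<phi>)"
| "subs (And \<phi> \<psi>) = insert (And \<phi> \<psi>) (subs \<phi> \<union> subs \<psi>)"
| "subs (Or \<phi> \<psi>) = insert (Or \<phi> \<psi>) (subs \<phi> \<union> subs \<psi>)"
| "subs (Imp \<phi> \<psi>) = insert (Imp \<phi> \<psi>) (subs \<phi> \<union> subs \<psi>)"
| "subs (Dia \<phi>) = insert (Dia \<phi>) (subs \<phi>)"

lemma finite_subs: "finite (subs \<phi>)"
  by (induction \<phi>) auto

lemma subs_refl: "\<phi> \<in> subs \<phi>"
  by (cases \<phi>) auto

lemma subs_trans: "\<psi> \<in> subs \<phi> \<Longrightarrow> subs \<psi> \<subseteq> subs \<phi>"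
  by (induction \<phi>) auto

text \<open>Every quotient edge is the image of an edge, so true diamonds stay true; a diamond true
  in the quotient is witnessed at some preimage of \<open>g w\<close>, which agrees with
  \<open>w\<close> on subformulas.\<close>

lemma filtration:
  assumes F: "is_frame F" "valuation F \<theta>"
    and g: "\<And>x y \<psi>. \<lbrakk>x \<in> worlds F; y \<in> worlds F; g x = g y; \<psi> \<in> subs \<phi>\<rbrakk>
           \<Longrightarrow> holds F \<theta> x \<psi> \<longleftrightarrow> holds F \<theta> y \<psi>"
    and "w \<in> worlds F" "\<psi> \<in> subs \<phi>"
  shows "holds (copy_frame g F) (\<lambda>p. g ` \<theta> p) (g w) \<psi> \<longleftrightarrow> holds F \<theta> w \<psi>"
  using assms(4,5)
proof (induction \<psi> arbitrary: w)
  case (Var p)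
  have "\<theta> p \<subseteq> worlds F" using F(2) by (simp add: valuation_def)
  then show ?case using g[OF Var(1) _ _ Var(2)] by auto
next
  case (Dia \<psi>)
  have "\<psi> \<in> subs \<phi>" using subs_trans[OF Dia.prems(2)] subs_refl[of \<psi>] by auto
  then have IH: "holds (copy_frame g F) (\<lambda>p. g ` \<theta> p) (g w) \<psi> \<longleftrightarrow> holds F \<theta> w \<psi>"
    if "w \<in> worlds F" for w
    using Dia.IH[OF that] by blast
  show ?case
  proof
    assume "holds (copy_frame g F) (\<lambda>p. g ` \<theta> p) (g w) (Dia \<psi>)"
    then obtain x y where xy: "(x, y) \<in> acc F" "g w = g x"
      and y: "holds (copy_frame g F) (\<lambda>p. g ` \<theta> p) (g y) \<psi>"
      by auto
    then have "holds F \<theta> y \<psi>" using IH acc_worlds[OF F(1)] by blast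
    then have "holds F \<theta> x (Dia \<psi>)" using xy by auto
    then show "holds F \<theta> w (Dia \<psi>)"
      using g[OF Dia.prems(1) _ xy(2) Dia.prems(2)] acc_worlds[OF F(1) xy(1)] by blast
  next
    assume "holds F \<theta> w (Dia \<psi>)"
    then obtain y where "(w, y) \<in> acc F" "holds F \<theta> y \<psi>" by auto
    then show "holds (copy_frame g F) (\<lambda>p. g ` \<theta> p) (g w) (Dia \<psi>)"
      using IH acc_worlds[OF F(1)] by (auto intro!: exI[of _ "g y"])
  qed
next
  case (Neg \<psi>)
  then show ?case using subs_trans[OF Neg.prems(2)] subs_refl[of \<psi>] by auto
next
  case (And \<psi>1 \<psi>2)
  then show ?case
    using subs_trans[OF And.prems(2)] subs_refl[of \<psi>1] subs_refl[of \<psi>2] by auto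
next
  case (Or \<psi>1 \<psi>2)
  then show ?case
    using subs_trans[OF Or.prems(2)] subs_refl[of \<psi>1] subs_refl[of \<psi>2] by auto
next
  case (Imp \<psi>1 \<psi>2)
  then show ?case
    using subs_trans[OF Imp.prems(2)] subs_refl[of \<psi>1] subs_refl[of \<psi>2] by auto
qed auto

section \<open>Lifting of paths and preservation of the frame conditions\<close>

text \<open>A \<open>p\<close>-morphism is the special case where \<open>j\<close> can always be taken to be \<open>0\<close>.\<close>

definition lifting :: "nat \<Rightarrow> ('w \<Rightarrow> 'v) \<Rightarrow> 'w frame \<Rightarrow> bool" where
  "lifting p g F \<longleftrightarrow> (\<forall>x\<in>worlds F. \<forall>z. (g x, z) \<in> acc (copy_frame g F) \<longrightarrow>
     (\<exists>y j. z = g y \<and> (x, y) \<in> acc F ^^ (1 + p * j)))"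

lemma lifting_relpow:
  assumes "is_frame F" "lifting p g F" "x \<in> worlds F" "(g x, z) \<in> acc (copy_frame g F) ^^ k"
  shows "\<exists>y j. z = g y \<and> (x, y) \<in> acc F ^^ (k + p * j)"
  using assms(4)
proof (induction k arbitrary: z)
  case 0
  then show ?case by (intro exI[of _ x] exI[of _ 0]) simp
next
  case (Suc k)
  then obtain u where u: "(g x, u) \<in> acc (copy_frame g F) ^^ k" "(u, z) \<in> acc (copy_frame g F)"
    by auto
  obtain y j where y: "u = g y" "(x, y) \<in> acc F ^^ (k + p * j)" using Suc.IH[OF u(1)] by blast
  have "y \<in> worlds F" using relpow_worlds[OF assms(1,3) y(2)] .
  then obtain v i where v: "z = g v" "(y, v) \<in> acc F ^^ (1 + p * i)"
    using assms(2) u(2) y(1) unfolding lifting_def by blast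
  have "(x, v) \<in> acc F ^^ ((k + p * j) + (1 + p * i))"
    using y(2) v(2) by (metis relcompI relpow_add)
  moreover have "(k + p * j) + (1 + p * i) = Suc k + p * (j + i)"
    by (simp add: algebra_simps)
  ultimately show ?case using v(1) by metis
qed

lemma lifting_rtrancl:
  assumes "is_frame F" "lifting p g F" "x \<in> worlds F" "(g x, z) \<in> (acc (copy_frame g F))\<^sup>*"
  shows "\<exists>y. z = g y \<and> (x, y) \<in> (acc F)\<^sup>*"
  using assms lifting_relpow by (metis relpow_imp_rtrancl rtrancl_imp_relpow)

text \<open>This is why surplus lengths are counted in multiples of \<open>n - m\<close>: once all
  but the last \<open>n - m\<close> steps are shortened to \<open>m\<close>, exactly
  \<open>n\<close> steps remain, and these shorten again.\<close>

lemma relpow_reduce: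
  fixes R :: "('a \<times> 'a) set"
  assumes "R ^^ n \<subseteq> R ^^ m" "m \<le> n"
  shows "R ^^ (n + (n - m) * j) \<subseteq> R ^^ m"
proof (induction j)
  case 0
  then show ?case using assms by simp
next
  case (Suc j)
  have "n + (n - m) * Suc j = (n + (n - m) * j) + (n - m)" by simp
  then have "R ^^ (n + (n - m) * Suc j) = R ^^ (n + (n - m) * j) O R ^^ (n - m)"
    by (simp only: relpow_add)
  also have "\<dots> \<subseteq> R ^^ m O R ^^ (n - m)" using Suc by blast
  also have "\<dots> = R ^^ n" using assms(2) by (simp flip: relpow_add)
  finally show ?case using assms(1) by blast
qed

lemma mn_frames_copy_frame:
  assumes "F \<in> mn_frames m n" "m < n" "lifting (n - m) g F"
  shows "copy_frame g F \<in> mn_frames m n"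
proof -
  have F: "is_frame F" "acc F ^^ n \<subseteq> acc F ^^ m" using assms(1) by (auto simp: mn_frames_def)
  have "(a, b) \<in> acc (copy_frame g F) ^^ m" if ab: "(a, b) \<in> acc (copy_frame g F) ^^ n" for a b
  proof -
    \<comment> \<open>\<open>n > 0\<close> provides a first edge, which puts \<open>a\<close> in the
      image of the worlds; a zeroth power would also relate points outside the frame.\<close>
    obtain c where "(a, c) \<in> acc (copy_frame g F)" using ab assms(2)
      by (metis gr_implies_not0 not0_implies_Suc relpow_Suc_D2)
    then obtain x where x: "x \<in> worlds F" "a = g x" using acc_worlds[OF F(1)] by auto
    then obtain y j where "b = g y" "(x, y) \<in> acc F ^^ (n + (n - m) * j)"
      using lifting_relpow[OF F(1) assms(3)] ab by blast
    then show ?thesis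
      using relpow_reduce[OF F(2)] assms(2) x relpow_map_prod by fastforce
  qed
  then show ?thesis using is_frame_copy_frame[OF F(1)] by (auto simp: mn_frames_def)
qed

text \<open>For \<open>p = 1\<close> lifting keeps only reachability. This suffices:
  \<open>m\<close>-transitivity of \<open>F\<close> shortens the lifted path, and the short path
  maps forward along \<open>g\<close>.\<close>

lemma m_transitive_frames_copy_frame:
  assumes "F \<in> m_transitive_frames m" "lifting 1 g F"
  shows "copy_frame g F \<in> m_transitive_frames m"
proof -
  have F: "is_frame F" "(acc F)\<^sup>* = (\<Union>i\<le>m. acc F ^^ i)"
    using assms(1) by (auto simp: m_transitive_frames_def)
  let ?R = "acc (copy_frame g F)"
  have "(a, b) \<in> (\<Union>i\<le>m. ?R ^^ i)" if ab: "(a, b) \<in> ?R\<^sup>*" for a b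
  proof (cases "a = b")
    \<comment> \<open>The closure is reflexive on the whole type, so \<open>a\<close> need not have
      a preimage; \<open>i = 0\<close> is used instead of lifting.\<close>
    case True
    then show ?thesis by (auto intro!: bexI[of _ 0])
  next
    case False
    then obtain c where "(a, c) \<in> ?R" using ab by (metis converse_rtranclE)
    then obtain x where x: "x \<in> worlds F" "a = g x" using acc_worlds[OF F(1)] by auto
    then obtain y where y: "b = g y" "(x, y) \<in> (acc F)\<^sup>*"
      using lifting_rtrancl[OF F(1) assms(2)] ab by blast
    then obtain i where "i \<le> m" "(x, y) \<in> acc F ^^ i" using F(2) by auto
    then show ?thesis using x y relpow_map_prod by fastforce
  qed
  then have "?R\<^sup>* = (\<Union>i\<le>m. ?R ^^ i)" by (auto intro: relpow_imp_rtrancl)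
  then show ?thesis using is_frame_copy_frame[OF F(1)] by (simp add: m_transitive_frames_def)
qed

section \<open>Depth and height\<close>

text \<open>Points from which strictly ascending chains contain at most \<open>d\<close> clusters.
  The recursion on points supplies the inductions that the supremum in \<open>height\<close> does
  not offer.\<close>

primrec depth_le :: "'w frame \<Rightarrow> nat \<Rightarrow> 'w set" where
  "depth_le F 0 = {}"
| "depth_le F (Suc d) =
    {x \<in> worlds F. \<forall>y. (x, y) \<in> (acc F)\<^sup>* \<and> (y, x) \<notin> (acc F)\<^sup>* \<longrightarrow> y \<in> depth_le F d}"

lemma depth_le_worlds: "depth_le F d \<subseteq> worlds F"
  by (cases d) auto

text \<open>The chain is built downwards: the cluster of \<open>x\<close> is put beneath a chain
  starting at a strict successor outside the next smaller depth. The last conjunct keeps the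
  induction going.\<close>

lemma long_chain:
  assumes "is_frame F" "x \<in> worlds F" "x \<notin> depth_le F d"
  shows "\<exists>C\<in>Chains (skeleton F). finite C \<and> card C = Suc d
           \<and> (\<forall>X\<in>C. (cluster_rel F `` {x}, X) \<in> skeleton F)"
  using assms(2,3)
proof (induction d arbitrary: x)
  case 0
  then show ?case
    by (intro bexI[of _ "{cluster_rel F `` {x}}"]) (auto simp: Chains_def skeleton_iff)
next
  case (Suc d)
  then obtain y where y: "(x, y) \<in> (acc F)\<^sup>*" "(y, x) \<notin> (acc F)\<^sup>*" "y \<notin> depth_le F d"
    by auto
  have yW: "y \<in> worlds F" using rtrancl_worlds[OF assms(1) Suc.prems(1) y(1)] .
  obtain C where C: "C \<in> Chains (skeleton F)" "finite C" "card C = Suc d"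
    "\<forall>X\<in>C. (cluster_rel F `` {y}, X) \<in> skeleton F"
    using Suc.IH[OF yW y(3)] by blast
  let ?x = "cluster_rel F `` {x}" and ?y = "cluster_rel F `` {y}"
  have xy: "(?x, ?y) \<in> skeleton F" using skeleton_iff[OF Suc.prems(1) yW] y(1) by simp
  have xx: "(?x, ?x) \<in> skeleton F" using skeleton_iff[OF Suc.prems(1) Suc.prems(1)] by simp
  have "?x \<notin> C" using C(4) skeleton_iff[OF yW Suc.prems(1)] y(2) by auto
  moreover have "trans (skeleton F)"
    using partial_order_on_skeleton[of F] by (simp add: partial_order_on_def preorder_on_def)
  then have below: "\<forall>X\<in>insert ?x C. (?x, X) \<in> skeleton F"
    using C(4) xy xx by (auto dest: transD)
  then have "insert ?x C \<in> Chains (skeleton F)" using C(1) by (auto simp: Chains_def)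
  ultimately show ?case using below C(2,3)
    by (intro bexI[of _ "insert ?x C"]) auto
qed

text \<open>One direction is \<open>long_chain\<close>. For the other, the least depth of a point
  strictly decreases along strict reachability, hence is injective on every chain.\<close>

lemma height_le_iff:
  assumes "is_frame F"
  shows "height F \<le> enat h \<longleftrightarrow> worlds F \<subseteq> depth_le F h"
proof
  assume h: "height F \<le> enat h"
  show "worlds F \<subseteq> depth_le F h"
  proof (rule ccontr)
    assume "\<not> worlds F \<subseteq> depth_le F h"
    then obtain C where "C \<in> Chains (skeleton F)" "finite C" "card C = Suc h"
      using long_chain[OF assms] by blast
    then have "enat (Suc h) \<le> height F"
      unfolding height_def by (metis (mono_tags, lifting) SUP_upper)
    with h show False by (metis enat_ord_simps(1) not_less_eq_eq order_refl order_trans)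
  qed
next
  assume W: "worlds F \<subseteq> depth_le F h"
  define rk where "rk x = (LEAST d. x \<in> depth_le F d)" for x
  have rk_mem: "x \<in> depth_le F (rk x)" "rk x \<le> h" if "x \<in> worlds F" for x
    using that W unfolding rk_def by (auto intro: LeastI Least_le)
  have rk_less: "rk y < rk x"
    if "x \<in> worlds F" "(x, y) \<in> (acc F)\<^sup>*" "(y, x) \<notin> (acc F)\<^sup>*" for x y
  proof (cases "rk x")
    case 0
    then show ?thesis using rk_mem(1)[OF that(1)] by simp
  next
    case (Suc d)
    then have "y \<in> depth_le F d" using rk_mem(1)[OF that(1)] that by simp
    then have "rk y \<le> d" unfolding rk_def by (rule Least_le)
    then show ?thesis using Suc by simp
  qed
  show "height F \<le> enat h" unfolding height_def
  proof (rule SUP_least)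
    fix C assume C: "C \<in> Chains (skeleton F)"
    have CW: "\<exists>x\<in>worlds F. X = cluster_rel F `` {x}" if "X \<in> C" for X
    proof -
      have "(X, X) \<in> skeleton F" using C that by (auto simp: Chains_def)
      then show ?thesis unfolding skeleton_def by blast
    qed
    then obtain r where r: "\<And>X. X \<in> C \<Longrightarrow> r X \<in> worlds F \<and> X = cluster_rel F `` {r X}"
      by metis
    define e where "e = rk \<circ> r"
    have "inj_on e C"
    proof (rule inj_onI, rule ccontr)
      fix X Y assume XY: "X \<in> C" "Y \<in> C" "e X = e Y" "X \<noteq> Y"
      have rel: "(X, Y) \<in> skeleton F \<longleftrightarrow> (r X, r Y) \<in> (acc F)\<^sup>*"
        "(Y, X) \<in> skeleton F \<longleftrightarrow> (r Y, r X) \<in> (acc F)\<^sup>*"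
        using skeleton_iff[of "r X" F "r Y"] skeleton_iff[of "r Y" F "r X"]
          r[OF XY(1)] r[OF XY(2)] by simp_all
      \<comment> \<open>Of two distinct clusters in a chain exactly one sees the other, so their
        representatives are strictly related and have different ranks.\<close>
      have "antisym (skeleton F)"
        using partial_order_on_skeleton[of F] by (simp add: partial_order_on_def)
      then have "((X, Y) \<in> skeleton F) \<noteq> ((Y, X) \<in> skeleton F)"
        using C XY by (auto simp: Chains_def dest: antisymD)
      then have "rk (r X) \<noteq> rk (r Y)"
        using rel rk_less[of "r X" "r Y"] rk_less[of "r Y" "r X"] r XY(1,2) by auto
      then show False using XY(3) by (simp add: e_def)
    qed
    \<comment> \<open>\<open>depth_le F 0\<close> is empty, so ranks start at 1 and only
      \<open>h\<close> values are possible, not \<open>h + 1\<close>.\<close>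
    moreover have "e ` C \<subseteq> {1..h}"
    proof
      fix d assume "d \<in> e ` C"
      then obtain x where x: "x \<in> worlds F" "d = rk x" using r by (auto simp: e_def)
      have "rk x \<noteq> 0"
      proof
        assume "rk x = 0"
        then show False using rk_mem(1)[OF x(1)] by simp
      qed
      then show "d \<in> {1..h}" using rk_mem(2)[OF x(1)] x(2) by simp
    qed
    ultimately have "finite C" "card C \<le> card {1..h}"
      using inj_on_finite card_inj_on_le by blast+
    then show "(if finite C then enat (card C) else \<infinity>) \<le> enat h" by simp
  qed
qed

text \<open>Depth cannot grow: a strict successor of \<open>g x\<close> lifts to a successor of
  \<open>x\<close>, again strict because a path back to \<open>x\<close> would map to a path back to
  \<open>g x\<close>.\<close>

lemma depth_le_copy_frame:
  assumes "is_frame F" "lifting p g F"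
  shows "g ` depth_le F d \<subseteq> depth_le (copy_frame g F) d"
proof (induction d)
  case (Suc d)
  show ?case
  proof
    fix a assume "a \<in> g ` depth_le F (Suc d)"
    then obtain x where x: "a = g x" "x \<in> depth_le F (Suc d)" by blast
    have xW: "x \<in> worlds F" using x(2) by simp
    have "z \<in> depth_le (copy_frame g F) d"
      if z: "(a, z) \<in> (acc (copy_frame g F))\<^sup>*" "(z, a) \<notin> (acc (copy_frame g F))\<^sup>*" for z
    proof -
      obtain y where y: "z = g y" "(x, y) \<in> (acc F)\<^sup>*"
        using lifting_rtrancl[OF assms xW] z(1) x(1) by blast
      then have "(y, x) \<notin> (acc F)\<^sup>*" using rtrancl_map_prod z(2) x(1) by fastforce
      then have "y \<in> depth_le F d" using x(2) y(2) by simp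
      then show ?thesis using Suc y(1) by blast
    qed
    then show "a \<in> depth_le (copy_frame g F) (Suc d)" using x(1) xW by auto
  qed
qed simp

lemma height_copy_frame:
  assumes "is_frame F" "lifting p g F" "height F \<le> enat h"
  shows "height (copy_frame g F) \<le> enat h"
proof -
  have "worlds F \<subseteq> depth_le F h" using assms(1,3) by (simp add: height_le_iff)
  then have "g ` worlds F \<subseteq> depth_le (copy_frame g F) h"
    using depth_le_copy_frame[OF assms(1,2), of h] by blast
  then show ?thesis using height_le_iff[OF is_frame_copy_frame[OF assms(1)], of g h] by simp
qed

section \<open>Filtrating clusters\<close>

text \<open>Quotients are realised by choosing a representative of each class, so they are again
  frames over \<open>'w\<close> and can belong to the same class of frames.\<close>

lemma equiv_representatives:
  assumes "equiv A S"
  obtains r where "\<And>x. x \<in> A \<Longrightarrow> (x, r x) \<in> S"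
    and "\<And>x y. \<lbrakk>x \<in> A; y \<in> A\<rbrakk> \<Longrightarrow> r x = r y \<longleftrightarrow> (x, y) \<in> S"
proof -
  define r where "r x = (SOME y. y \<in> S `` {x})" for x
  have r: "(x, r x) \<in> S" if "x \<in> A" for x
    unfolding r_def using someI[of "\<lambda>y. y \<in> S `` {x}" x] equiv_class_self[OF assms that] by simp
  have "r x = r y \<longleftrightarrow> (x, y) \<in> S" if xy: "x \<in> A" "y \<in> A" for x y
  proof
    assume "r x = r y"
    then show "(x, y) \<in> S" using r xy assms
      by (metis equiv_def symD transD)
  next
    assume "(x, y) \<in> S"
    then show "r x = r y" unfolding r_def using equiv_class_eq[OF assms] by metis
  qed
  with r that show ?thesis by blast
qed

section \<open>Paths of length divisible by \<open>p\<close>\<close>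

definition cyc :: "'w frame \<Rightarrow> nat \<Rightarrow> ('w \<times> 'w) set" where
  "cyc F p = {(x, y). (\<exists>k. (x, y) \<in> acc F ^^ (p * k)) \<and> (\<exists>k. (y, x) \<in> acc F ^^ (p * k))}"

lemma cyc_refl: "(x, x) \<in> cyc F p"
  unfolding cyc_def by (auto intro!: exI[of _ 0])

lemma cyc_sym: "(x, y) \<in> cyc F p \<Longrightarrow> (y, x) \<in> cyc F p"
  unfolding cyc_def by auto

lemma cyc_trans:
  assumes "(x, y) \<in> cyc F p" "(y, z) \<in> cyc F p"
  shows "(x, z) \<in> cyc F p"
proof -
  have *: "\<exists>k. (x, z) \<in> acc F ^^ (p * k)"
    if "(x, y) \<in> acc F ^^ (p * i)" "(y, z) \<in> acc F ^^ (p * j)" for x y z i j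
    using that relpow_add[of "p * i" "p * j" "acc F"]
    by (intro exI[of _ "i + j"]) (auto simp: distrib_left)
  show ?thesis using assms * unfolding cyc_def by blast
qed

lemma relpow_loop:
  "(x, x) \<in> R ^^ k \<Longrightarrow> (x, x) \<in> R ^^ (k * j)"
proof (induction j)
  case (Suc j)
  then show ?case using relpow_add[of k "k * j" R] by auto
qed simp

text \<open>Closing up \<open>x \<rightarrow> c \<rightarrow> x\<close> to a loop and running through it \<open>p - 1\<close> times corrects the residue
  of the length of \<open>x \<rightarrow> c \<rightarrow> y\<close>.\<close>

lemma residue_imp_cyc:
  fixes F :: "'w frame"
  assumes "p > 0" "(c, x) \<in> acc F ^^ k" "(c, y) \<in> acc F ^^ l" "k mod p = l mod p"
    and "(x, c) \<in> (acc F)\<^sup>*" "(y, c) \<in> (acc F)\<^sup>*"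
  shows "(x, y) \<in> cyc F p"
proof -
  have *: "\<exists>i. (x, y) \<in> acc F ^^ (p * i)"
    if "(c, x) \<in> acc F ^^ k" "(c, y) \<in> acc F ^^ l" "k mod p = l mod p" "(x, c) \<in> (acc F)\<^sup>*"
    for x y k l
  proof -
    obtain j where j: "(x, c) \<in> acc F ^^ j" using \<open>(x, c) \<in> (acc F)\<^sup>*\<close> rtrancl_imp_relpow by blast
    have "(x, x) \<in> acc F ^^ (j + k)" using j that(1) by (metis relcompI relpow_add)
    then have "(x, x) \<in> acc F ^^ ((j + k) * (p - 1))" by (rule relpow_loop)
    moreover have "(x, y) \<in> acc F ^^ (j + l)" using j that(2) by (metis relcompI relpow_add)
    ultimately have 1: "(x, y) \<in> acc F ^^ ((j + k) * (p - 1) + (j + l))"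
      by (metis relcompI relpow_add)
    have "((j + k) * (p - 1) + (j + l)) mod p = ((j + k) * (p - 1) + (j + k)) mod p"
      using that(3) by (metis mod_add_right_eq)
    also have "(j + k) * (p - 1) + (j + k) = (j + k) * p"
      using assms(1) by (cases p) (auto simp: algebra_simps)
    finally have "p dvd (j + k) * (p - 1) + (j + l)" by (simp add: mod_eq_0_iff_dvd)
    then show ?thesis using 1 by (metis dvdE)
  qed
  show ?thesis unfolding cyc_def
    using *[OF assms(2,3,4,5)] *[OF assms(3,2) assms(4)[symmetric] assms(6)] by blast
qed

text \<open>Bounded cluster size is expressed by labels \<open>f\<close> from a finite set that
  separate the points of each quotient cluster. A label holds the true subformulas and the residue
  of the length of a path from a base point of the cluster.\<close>

lemma cluster_filtration:
  fixes F :: "'w frame"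
  assumes F: "is_frame F" and p: "p > 0"
  obtains g :: "'w \<Rightarrow> 'w" and f :: "'w \<Rightarrow> fm set \<times> nat" where
    "lifting p g F"
    "\<And>x y \<psi>. \<lbrakk>x \<in> worlds F; y \<in> worlds F; g x = g y; \<psi> \<in> subs \<phi>\<rbrakk>
           \<Longrightarrow> holds F \<theta> x \<psi> \<longleftrightarrow> holds F \<theta> y \<psi>"
    "finite (range f)"
    "\<And>x y. \<lbrakk>(x, y) \<in> cluster_rel (copy_frame g F); f x = f y\<rbrakk> \<Longrightarrow> x = y"
proof -
  define T where "T x = {\<psi> \<in> subs \<phi>. holds F \<theta> x \<psi>}" for x
  define S where "S = {(x, y). x \<in> worlds F \<and> y \<in> worlds F \<and> T x = T y \<and> (x, y) \<in> cyc F p}"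
  have "equiv (worlds F) S"
    by (rule equivI)
      (auto simp: S_def refl_on_def sym_def trans_def cyc_refl intro: cyc_sym cyc_trans)
  then obtain g where g: "\<And>x. x \<in> worlds F \<Longrightarrow> (x, g x) \<in> S"
    and g_eq: "\<And>x y. \<lbrakk>x \<in> worlds F; y \<in> worlds F\<rbrakk> \<Longrightarrow> g x = g y \<longleftrightarrow> (x, y) \<in> S"
    using equiv_representatives by blast
  have lift: "lifting p g F"
    unfolding lifting_def
  proof (intro ballI allI impI)
    fix x z assume x: "x \<in> worlds F" and z: "(g x, z) \<in> acc (copy_frame g F)"
    \<comment> \<open>\<open>u\<close> is the preimage of \<open>g x\<close> that carries the edge;
      getting from \<open>x\<close> to \<open>u\<close> costs a multiple of
      \<open>p\<close>.\<close>
    then obtain u y where u: "(u, y) \<in> acc F" "g x = g u" "z = g y" by auto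
    then have "(x, u) \<in> S" using g_eq x acc_worlds[OF F] by blast
    then obtain j where "(x, u) \<in> acc F ^^ (p * j)" by (auto simp: S_def cyc_def)
    then have "(x, y) \<in> acc F ^^ (1 + p * j)" using u(1) by auto
    then show "\<exists>y j. z = g y \<and> (x, y) \<in> acc F ^^ (1 + p * j)" using u(3) by blast
  qed
  \<comment> \<open>The choice depends only on the cluster as a set, so all its points share one
    base point.\<close>
  define c where "c x = (SOME y. y \<in> cluster_rel F `` {x})" for x
  define k where "k x = (SOME i. (c x, x) \<in> acc F ^^ i)" for x
  define f where "f x = (T x, k x mod p)" for x
  have c: "(x, c x) \<in> cluster_rel F" if "x \<in> worlds F" for x
    unfolding c_def using someI[of "\<lambda>y. y \<in> cluster_rel F `` {x}" x]
      equiv_class_self[OF equiv_cluster_rel that] by simp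
  have k: "(c x, x) \<in> acc F ^^ k x" if "x \<in> worlds F" for x
  proof -
    have "(c x, x) \<in> (acc F)\<^sup>*" using c[OF that] by (simp add: cluster_rel_def)
    then show ?thesis unfolding k_def using someI_ex rtrancl_imp_relpow by metis
  qed
  show ?thesis
  proof (rule that[OF lift])
    show "holds F \<theta> x \<psi> \<longleftrightarrow> holds F \<theta> y \<psi>"
      if "x \<in> worlds F" "y \<in> worlds F" "g x = g y" "\<psi> \<in> subs \<phi>" for x y \<psi>
      using that g_eq by (fastforce simp: S_def T_def)
    \<comment> \<open>Points outside the frame are covered too: both components stay within these
      bounds whatever the choices return.\<close>
    have "range f \<subseteq> Pow (subs \<phi>) \<times> {..<p}" using p by (auto simp: f_def T_def)
    then show "finite (range f)" by (rule finite_subset) (simp add: finite_subs)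
  next
    fix a b assume ab: "(a, b) \<in> cluster_rel (copy_frame g F)" "f a = f b"
    \<comment> \<open>Worlds of the quotient are the chosen representatives, themselves worlds of
      \<open>F\<close>, so labels computed in \<open>F\<close> apply to them.\<close>
    have gg: "g a = a" "a \<in> worlds F" if "a \<in> g ` worlds F" for a
      using that g g_eq by (fastforce simp: S_def)+
    have "a \<in> g ` worlds F" "b \<in> g ` worlds F" using ab(1) by (simp_all add: cluster_rel_def)
    then have a: "g a = a" "a \<in> worlds F" and b: "g b = b" "b \<in> worlds F"
      using gg by blast+
    \<comment> \<open>Reachability in the quotient reflects back to \<open>F\<close>: the lifted
      path ends at some \<open>v\<close> identified with \<open>y\<close>, and \<open>cyc\<close>
      leads on to \<open>y\<close>. Hence \<open>a\<close> and \<open>b\<close> share a cluster of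
      \<open>F\<close>.\<close>
    have reach: "(x, y) \<in> (acc F)\<^sup>*"
      if xy: "x \<in> worlds F" "y \<in> worlds F" "(g x, g y) \<in> (acc (copy_frame g F))\<^sup>*" for x y
    proof -
      obtain v where v: "g y = g v" "(x, v) \<in> (acc F)\<^sup>*"
        using lifting_rtrancl[OF F lift xy(1,3)] by blast
      then have "(y, v) \<in> S" using g_eq xy rtrancl_worlds[OF F xy(1) v(2)] by blast
      then have "(v, y) \<in> (acc F)\<^sup>*" by (auto simp: S_def cyc_def intro: relpow_imp_rtrancl)
      then show ?thesis using v(2) by simp
    qed
    have "(g a, g b) \<in> (acc (copy_frame g F))\<^sup>*" "(g b, g a) \<in> (acc (copy_frame g F))\<^sup>*"
      using ab(1) unfolding a(1) b(1) cluster_rel_def by simp_all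
    then have "(a, b) \<in> cluster_rel F" using reach a b by (simp add: cluster_rel_def)
    then have cc: "c a = c b"
      unfolding c_def using equiv_class_eq[OF equiv_cluster_rel] by metis
    have "(a, b) \<in> cyc F p"
    proof (rule residue_imp_cyc[OF p])
      show "(c a, a) \<in> acc F ^^ k a" "(c a, b) \<in> acc F ^^ k b" "k a mod p = k b mod p"
        using k[OF a(2)] k[OF b(2)] cc ab(2) by (simp_all add: f_def)
      show "(a, c a) \<in> (acc F)\<^sup>*" "(b, c a) \<in> (acc F)\<^sup>*"
        using c[OF a(2)] c[OF b(2)] cc by (simp_all add: cluster_rel_def)
    qed
    then have "(a, b) \<in> S" using a b ab(2) by (simp add: S_def f_def)
    then show "a = b" using g_eq a b by metis
  qed
qed

section \<open>Quotients by bisimilarity\<close>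

text \<open>Symmetry makes the forth clause serve as the back clause. Comparing only variables in
  \<open>V\<close> leaves finitely many atomic types when \<open>V\<close> is finite.\<close>

definition bisim :: "'w frame \<Rightarrow> (nat \<Rightarrow> 'w set) \<Rightarrow> nat set \<Rightarrow> ('w \<times> 'w) set \<Rightarrow> bool" where
  "bisim F \<theta> V Z \<longleftrightarrow> Z \<subseteq> worlds F \<times> worlds F \<and> sym Z \<and>
     (\<forall>x y. (x, y) \<in> Z \<longrightarrow> (\<forall>p\<in>V. x \<in> \<theta> p \<longleftrightarrow> y \<in> \<theta> p) \<and>
        (\<forall>x'. (x, x') \<in> acc F \<longrightarrow> (\<exists>y'. (y, y') \<in> acc F \<and> (x', y') \<in> Z)))"

definition bisimilar :: "'w frame \<Rightarrow> (nat \<Rightarrow> 'w set) \<Rightarrow> nat set \<Rightarrow> ('w \<times> 'w) set" where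
  "bisimilar F \<theta> V = \<Union>{Z. bisim F \<theta> V Z}"

lemma bisim_subset: "bisim F \<theta> V Z \<Longrightarrow> Z \<subseteq> bisimilar F \<theta> V"
  unfolding bisimilar_def by blast

lemma bisim_bisimilar: "bisim F \<theta> V (bisimilar F \<theta> V)"
  unfolding bisim_def
proof (intro conjI allI impI)
  show "bisimilar F \<theta> V \<subseteq> worlds F \<times> worlds F"
    by (auto simp: bisimilar_def bisim_def)
  show "sym (bisimilar F \<theta> V)"
    unfolding bisimilar_def by (auto simp: bisim_def intro!: sym_UNION[of _ "\<lambda>x. x", simplified])
  fix x y assume "(x, y) \<in> bisimilar F \<theta> V"
  then obtain Z where Z: "bisim F \<theta> V Z" "(x, y) \<in> Z" by (auto simp: bisimilar_def)
  then show "\<forall>p\<in>V. x \<in> \<theta> p \<longleftrightarrow> y \<in> \<theta> p" by (auto simp: bisim_def)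
  show "\<exists>y'. (y, y') \<in> acc F \<and> (x', y') \<in> bisimilar F \<theta> V" if "(x, x') \<in> acc F" for x'
    using Z that bisim_subset[OF Z(1)] unfolding bisim_def by blast
qed

lemma bisimilar_worlds: "(x, y) \<in> bisimilar F \<theta> V \<Longrightarrow> x \<in> worlds F \<and> y \<in> worlds F"
  using bisim_bisimilar[of F \<theta> V] unfolding bisim_def by blast

lemma bisimilar_atom:
  "\<lbrakk>(x, y) \<in> bisimilar F \<theta> V; p \<in> V\<rbrakk> \<Longrightarrow> x \<in> \<theta> p \<longleftrightarrow> y \<in> \<theta> p"
  using bisim_bisimilar[of F \<theta> V] unfolding bisim_def by blast

lemma bisimilar_forth:
  "\<lbrakk>(x, y) \<in> bisimilar F \<theta> V; (x, x') \<in> acc F\<rbrakk>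
     \<Longrightarrow> \<exists>y'. (y, y') \<in> acc F \<and> (x', y') \<in> bisimilar F \<theta> V"
  using bisim_bisimilar[of F \<theta> V] unfolding bisim_def by blast

lemma bisimilar_sym: "(x, y) \<in> bisimilar F \<theta> V \<Longrightarrow> (y, x) \<in> bisimilar F \<theta> V"
  using bisim_bisimilar[of F \<theta> V] unfolding bisim_def by (blast dest: symD)

text \<open>Bisimilarity is the largest bisimulation, so it contains the identity on worlds and its
  own composition with itself, both being bisimulations.\<close>

lemma equiv_bisimilar:
  assumes "is_frame F"
  shows "equiv (worlds F) (bisimilar F \<theta> V)"
proof (rule equivI)
  show "bisimilar F \<theta> V \<subseteq> worlds F \<times> worlds F" using bisimilar_worlds by fast
  have "bisim F \<theta> V (Id_on (worlds F))"
    using assms by (auto simp: bisim_def is_frame_def sym_def)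
  then show "refl_on (worlds F) (bisimilar F \<theta> V)"
    using bisim_subset unfolding refl_on_def by blast
  show "sym (bisimilar F \<theta> V)" using bisimilar_sym by (rule symI)
  let ?E = "bisimilar F \<theta> V"
  have "bisim F \<theta> V (?E O ?E)"
    unfolding bisim_def
  proof (intro conjI allI impI)
    show "?E O ?E \<subseteq> worlds F \<times> worlds F" using bisimilar_worlds by fast
    show "sym (?E O ?E)" by (rule symI) (blast intro: bisimilar_sym)
    fix x z assume "(x, z) \<in> ?E O ?E"
    then obtain y where y: "(x, y) \<in> ?E" "(y, z) \<in> ?E" by blast
    show "\<forall>p\<in>V. x \<in> \<theta> p \<longleftrightarrow> z \<in> \<theta> p" using y bisimilar_atom by metis
    show "\<exists>z'. (z, z') \<in> acc F \<and> (x', z') \<in> ?E O ?E" if "(x, x') \<in> acc F" for x'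
      using bisimilar_forth[OF y(1) that] bisimilar_forth[OF y(2)] by blast
  qed
  then show "trans ?E" using bisim_subset unfolding trans_def by blast
qed

lemma bisimilar_holds:
  assumes "(x, y) \<in> bisimilar F \<theta> V" "\<And>p. Var p \<in> subs \<phi> \<Longrightarrow> p \<in> V"
  shows "holds F \<theta> x \<phi> \<longleftrightarrow> holds F \<theta> y \<phi>"
  using assms
proof (induction \<phi> arbitrary: x y)
  case (Var p)
  then show ?case using bisimilar_atom by fastforce
next
  case (Dia \<phi>)
  have "holds F \<theta> y (Dia \<phi>)"
    if xy: "(x, y) \<in> bisimilar F \<theta> V" and x: "holds F \<theta> x (Dia \<phi>)" for x y
  proof -
    obtain x' where x': "(x, x') \<in> acc F" "holds F \<theta> x' \<phi>" using x by auto
    then obtain y' where "(y, y') \<in> acc F" "(x', y') \<in> bisimilar F \<theta> V"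
      using bisimilar_forth[OF xy] by blast
    then show ?thesis using Dia.IH[of x' y'] Dia.prems(2) x'(2) by auto
  qed
  from this[OF Dia.prems(1)] this[OF bisimilar_sym[OF Dia.prems(1)]] show ?case by (rule iffI)
next
  case (Neg \<phi>)
  then show ?case by simp
next
  case (And \<phi> \<psi>)
  show ?case using And.IH[OF And.prems(1)] And.prems(2) by simp
next
  case (Or \<phi> \<psi>)
  show ?case using Or.IH[OF Or.prems(1)] Or.prems(2) by simp
next
  case (Imp \<phi> \<psi>)
  show ?case using Imp.IH[OF Imp.prems(1)] Imp.prems(2) by simp
qed auto

section \<open>Counting points up to bisimilarity\<close>

lemma finite_image_factor:
  assumes "finite (c ` A)" "\<And>x y. \<lbrakk>x \<in> A; y \<in> A; c x = c y\<rbrakk> \<Longrightarrow> r x = r y"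
  shows "finite (r ` A)"
proof -
  have "r x = (r \<circ> inv_into A c) (c x)" if "x \<in> A" for x
    using assms(2)[OF that inv_into_into[of "c x" c A]] that by (simp add: f_inv_into_f)
  then have "r ` A \<subseteq> (r \<circ> inv_into A c) ` c ` A" by (simp add: image_subset_iff)
  then show ?thesis using assms(1) finite_surj by blast
qed

text \<open>Each point gets a code describing its cluster, with points named by \<open>f\<close>,
  and the classes of the points of smaller depth seen from there. Inductively there are finitely
  many codes, and equal codes imply bisimilarity.\<close>

lemma finite_bisimilarity_quotient:
  fixes F :: "'w frame" and f :: "'w \<Rightarrow> 'c"
  assumes F: "is_frame F" and V: "finite V" and f: "finite (range f)"
    and inj: "\<And>x y. \<lbrakk>(x, y) \<in> cluster_rel F; f x = f y\<rbrakk> \<Longrightarrow> x = y"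
    and r: "\<And>x y. \<lbrakk>x \<in> worlds F; y \<in> worlds F\<rbrakk> \<Longrightarrow> r x = r y \<longleftrightarrow> (x, y) \<in> bisimilar F \<theta> V"
  shows "finite (r ` depth_le F d)"
proof (induction d)
  case (Suc d)
  let ?E = "bisimilar F \<theta> V"
  define K where "K x = cluster_rel F `` {x}" for x
  define t where "t x = {p \<in> V. x \<in> \<theta> p}" for x
  \<comment> \<open>\<open>A\<close> records edges inside the cluster, \<open>B\<close> the atoms,
    and \<open>D\<close> the edges to points of depth at most \<open>d\<close>, whose targets enter
    only through their classes.\<close>
  define A where "A x = {(f a, f b) | a b. a \<in> K x \<and> b \<in> K x \<and> (a, b) \<in> acc F}" for x
  define B where "B x = {(f a, t a) | a. a \<in> K x}" for x
  define D where "D x = {(f a, r b) | a b. a \<in> K x \<and> b \<in> depth_le F d \<and> (a, b) \<in> acc F}" for x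
  define c where "c x = (f x, A x, B x, D x)" for x
  have K_iff: "a \<in> K x \<longleftrightarrow> (x, a) \<in> cluster_rel F" for a x by (simp add: K_def)
  have K_eq: "a = b" if "a \<in> K x" "b \<in> K x" "f a = f b" for a b x
    using that inj[of a b] equiv_cluster_rel[of F] unfolding K_iff
    by (meson equiv_def symD transD)
  \<comment> \<open>Points of the two clusters with the same name are matched; by
    \<open>K_eq\<close> a name occurs at most once in a cluster.\<close>
  define Z where "Z x y = {(a, b). a \<in> K x \<and> b \<in> K y \<and> f a = f b}" for x y
  have Z_atom: "a \<in> \<theta> p \<longleftrightarrow> b \<in> \<theta> p" if eq: "c x = c y" and ab: "(a, b) \<in> Z x y" and "p \<in> V"
    for x y a b p
  proof -
    have "(f a, t a) \<in> B x" using ab unfolding B_def Z_def by blast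
    then have "(f a, t a) \<in> B y" using eq by (simp add: c_def)
    then obtain b0 where "b0 \<in> K y" "f b0 = f a" "t b0 = t a" by (auto simp: B_def)
    then have "t a = t b" using K_eq[of b0 y b] ab by (auto simp: Z_def)
    then show ?thesis using \<open>p \<in> V\<close> by (auto simp: t_def)
  qed
  have Z_forth: "\<exists>b'. (b, b') \<in> acc F \<and> (a', b') \<in> Z x y \<union> ?E"
    if eq: "c x = c y" and x: "x \<in> depth_le F (Suc d)" and ab: "(a, b) \<in> Z x y"
      and a': "(a, a') \<in> acc F" for x y a b a'
  proof (cases "a' \<in> K x")
    case True
    then have "(f a, f a') \<in> A x" using ab a' unfolding A_def Z_def by blast
    then have "(f a, f a') \<in> A y" using eq by (simp add: c_def)
    then obtain b0 b' where b: "b0 \<in> K y" "b' \<in> K y" "(b0, b') \<in> acc F" "f b0 = f a" "f b' = f a'"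
      by (auto simp: A_def)
    then have "b0 = b" using K_eq[of b0 y b] ab by (auto simp: Z_def)
    then show ?thesis using b True by (auto simp: Z_def)
  next
    case False
    have "(x, a) \<in> (acc F)\<^sup>*" using ab by (simp add: Z_def K_iff cluster_rel_def)
    then have xa': "(x, a') \<in> (acc F)\<^sup>*" using a' by (rule rtrancl_into_rtrancl)
    \<comment> \<open>An edge leaving the cluster leads strictly upwards, so its target has depth at
      most \<open>d\<close> and is recorded in \<open>D\<close>.\<close>
    have "(a', x) \<notin> (acc F)\<^sup>*"
    proof
      assume "(a', x) \<in> (acc F)\<^sup>*"
      then have "a' \<in> K x"
        using xa' x acc_worlds[OF F a'] by (simp add: K_iff cluster_rel_def)
      then show False using False by blast
    qed
    then have dp: "a' \<in> depth_le F d" using x xa' by simp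
    then have "(f a, r a') \<in> D x" using ab a' unfolding D_def Z_def by blast
    then have "(f a, r a') \<in> D y" using eq by (simp add: c_def)
    then obtain b0 b' where b: "b0 \<in> K y" "b' \<in> depth_le F d" "(b0, b') \<in> acc F"
      "f b0 = f a" "r b' = r a'"
      by (auto simp: D_def)
    then have "b0 = b" using K_eq[of b0 y b] ab by (auto simp: Z_def)
    moreover have "(a', b') \<in> ?E"
      using r[of a' b'] b(2,5) dp depth_le_worlds[of F d] by auto
    ultimately show ?thesis using b by blast
  qed
  have "finite (c ` depth_le F (Suc d))"
  proof (rule finite_subset)
    let ?X = "range f \<times> Pow (range f \<times> range f) \<times> Pow (range f \<times> Pow V)
      \<times> Pow (range f \<times> r ` depth_le F d)"
    show "c ` depth_le F (Suc d) \<subseteq> ?X"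
      unfolding c_def A_def B_def D_def t_def by blast
    show "finite ?X" using f V Suc by simp
  qed
  moreover have "r x = r y"
    if xy: "x \<in> depth_le F (Suc d)" "y \<in> depth_le F (Suc d)" "c x = c y" for x y
  proof -
    \<comment> \<open>Edges leaving the matched clusters are answered within \<open>?E\<close>;
      \<open>Z y x\<close> makes the relation symmetric.\<close>
    have "bisim F \<theta> V (Z x y \<union> Z y x \<union> ?E)"
      unfolding bisim_def
    proof (intro conjI allI impI)
      show "Z x y \<union> Z y x \<union> ?E \<subseteq> worlds F \<times> worlds F"
        by (auto simp: Z_def K_iff cluster_rel_def dest: bisimilar_worlds)
      show "sym (Z x y \<union> Z y x \<union> ?E)"
        by (rule symI) (auto simp: Z_def intro: bisimilar_sym)
    next
      fix a b assume "(a, b) \<in> Z x y \<union> Z y x \<union> ?E"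
      then consider "(a, b) \<in> Z x y" | "(a, b) \<in> Z y x" | "(a, b) \<in> ?E" by blast
      note cs = this
      show "\<forall>p\<in>V. a \<in> \<theta> p \<longleftrightarrow> b \<in> \<theta> p"
        using cs Z_atom[OF xy(3)] Z_atom[OF xy(3)[symmetric]] bisimilar_atom[of a b F \<theta> V]
        by cases blast+
      show "\<exists>b'. (b, b') \<in> acc F \<and> (a', b') \<in> Z x y \<union> Z y x \<union> ?E"
        if "(a, a') \<in> acc F" for a'
        using cs
      proof cases
        case 1
        then show ?thesis using Z_forth[OF xy(3,1) _ that] by blast
      next
        case 2
        then show ?thesis using Z_forth[OF xy(3)[symmetric] xy(2) _ that] by blast
      next
        case 3
        then show ?thesis using bisimilar_forth[OF _ that] by blast
      qed
    qed
    moreover have "(x, y) \<in> Z x y"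
      using xy by (simp add: Z_def K_iff cluster_rel_def c_def)
    ultimately have "(x, y) \<in> ?E" using bisim_subset by blast
    then show ?thesis using r[of x y] bisimilar_worlds[of x y F \<theta> V] by blast
  qed
  ultimately show ?case by (rule finite_image_factor)
qed simp

text \<open>Bisimilarity lifts edges to edges, so \<open>lifting p\<close> holds for every
  \<open>p\<close>, whichever frame condition is to be preserved.\<close>

lemma bisimilarity_filtration:
  fixes F :: "'w frame" and f :: "'w \<Rightarrow> 'c"
  assumes F: "is_frame F" and h: "height F \<le> enat h" and f: "finite (range f)"
    and inj: "\<And>x y. \<lbrakk>(x, y) \<in> cluster_rel F; f x = f y\<rbrakk> \<Longrightarrow> x = y"
  obtains g :: "'w \<Rightarrow> 'w" where
    "\<And>p. lifting p g F" "finite (g ` worlds F)"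
    "\<And>x y \<psi>. \<lbrakk>x \<in> worlds F; y \<in> worlds F; g x = g y; \<psi> \<in> subs \<phi>\<rbrakk>
           \<Longrightarrow> holds F \<theta> x \<psi> \<longleftrightarrow> holds F \<theta> y \<psi>"
proof -
  define V where "V = {p. Var p \<in> subs \<phi>}"
  have "V = Var -` subs \<phi>" by (auto simp: V_def)
  then have V: "finite V" using finite_vimageI[OF finite_subs, of Var \<phi>] by (simp add: inj_def)
  obtain g :: "'w \<Rightarrow> 'w"
    where g: "\<And>x y. \<lbrakk>x \<in> worlds F; y \<in> worlds F\<rbrakk> \<Longrightarrow> g x = g y \<longleftrightarrow> (x, y) \<in> bisimilar F \<theta> V"
    using equiv_representatives[OF equiv_bisimilar[OF F]] by metis
  show ?thesis
  proof (rule that)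
    show "lifting p g F" for p
      unfolding lifting_def
    proof (intro ballI allI impI)
      fix x z assume x: "x \<in> worlds F" and z: "(g x, z) \<in> acc (copy_frame g F)"
      then obtain u v where u: "(u, v) \<in> acc F" "g x = g u" "z = g v" by auto
      then have "(u, x) \<in> bisimilar F \<theta> V" using g x acc_worlds[OF F] by metis
      then obtain y where y: "(x, y) \<in> acc F" "(v, y) \<in> bisimilar F \<theta> V"
        using bisimilar_forth u(1) by metis
      then have "z = g y" using g bisimilar_worlds u(3) by metis
      then show "\<exists>y j. z = g y \<and> (x, y) \<in> acc F ^^ (1 + p * j)"
        using y(1) by (intro exI[of _ y] exI[of _ 0]) simp
    qed
    have "worlds F \<subseteq> depth_le F h" using height_le_iff[OF F] h by simp
    then show "finite (g ` worlds F)"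
      using finite_bisimilarity_quotient[OF F V f inj g] by (meson finite_subset image_mono)
    show "holds F \<theta> x \<psi> \<longleftrightarrow> holds F \<theta> y \<psi>"
      if "x \<in> worlds F" "y \<in> worlds F" "g x = g y" "\<psi> \<in> subs \<phi>" for x y \<psi>
    proof (rule bisimilar_holds)
      show "(x, y) \<in> bisimilar F \<theta> V" using g that(1-3) by blast
      show "p \<in> V" if "Var p \<in> subs \<psi>" for p
        using that subs_trans[OF \<open>\<psi> \<in> subs \<phi>\<close>] by (auto simp: V_def)
    qed
  qed
qed

section \<open>The finite model property\<close>

text \<open>The first quotient bounds the clusters, which makes the second, by bisimilarity, finite.
  Closure of \<open>C\<close> under \<open>lifting p\<close> covers both frame conditions, and the
  height bound survives each step.\<close>

lemma finite_refuting_frame: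
  fixes F :: "'w frame"
  assumes F: "is_frame F" "F \<in> C" "height F \<le> enat h" "\<not> valid_in F \<phi>" and p: "p > 0"
    and C: "\<And>(F :: 'w frame) g. \<lbrakk>F \<in> C; lifting p g F\<rbrakk> \<Longrightarrow> copy_frame g F \<in> C"
  shows "\<exists>G\<in>C. height G \<le> enat h \<and> finite (worlds G) \<and> \<not> valid_in G \<phi>"
proof -
  obtain \<theta> w where w: "valuation F \<theta>" "w \<in> worlds F" "\<not> holds F \<theta> w \<phi>"
    using F(4) by (auto simp: valid_in_def)
  obtain g1 :: "'w \<Rightarrow> 'w" and f :: "'w \<Rightarrow> fm set \<times> nat" where
    g1: "lifting p g1 F"
    "\<And>x y \<psi>. \<lbrakk>x \<in> worlds F; y \<in> worlds F; g1 x = g1 y; \<psi> \<in> subs \<phi>\<rbrakk>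
           \<Longrightarrow> holds F \<theta> x \<psi> \<longleftrightarrow> holds F \<theta> y \<psi>"
    and f: "finite (range f)"
    "\<And>x y. \<lbrakk>(x, y) \<in> cluster_rel (copy_frame g1 F); f x = f y\<rbrakk> \<Longrightarrow> x = y"
    using cluster_filtration[OF F(1) p] by blast
  define F1 \<theta>1 where "F1 = copy_frame g1 F" and "\<theta>1 = (\<lambda>p. g1 ` \<theta> p)"
  have F1: "is_frame F1" "F1 \<in> C" "height F1 \<le> enat h"
    unfolding F1_def
    using is_frame_copy_frame[OF F(1)] C[OF F(2) g1(1)] height_copy_frame[OF F(1) g1(1) F(3)] by auto
  have w1: "valuation F1 \<theta>1" "g1 w \<in> worlds F1" "\<not> holds F1 \<theta>1 (g1 w) \<phi>"
    using filtration[OF F(1) w(1) g1(2) w(2) subs_refl] w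
    by (fastforce simp: F1_def \<theta>1_def valuation_def)+
  obtain g2 :: "'w \<Rightarrow> 'w" where
    g2: "\<And>p. lifting p g2 F1" "finite (g2 ` worlds F1)"
    "\<And>x y \<psi>. \<lbrakk>x \<in> worlds F1; y \<in> worlds F1; g2 x = g2 y; \<psi> \<in> subs \<phi>\<rbrakk>
           \<Longrightarrow> holds F1 \<theta>1 x \<psi> \<longleftrightarrow> holds F1 \<theta>1 y \<psi>"
    using bisimilarity_filtration[OF F1(1,3) f(1) f(2)[folded F1_def]] by blast
  have "\<not> holds (copy_frame g2 F1) (\<lambda>p. g2 ` \<theta>1 p) (g2 (g1 w)) \<phi>"
    using filtration[OF F1(1) w1(1) g2(3) w1(2) subs_refl] w1(3) by blast
  moreover have "valuation (copy_frame g2 F1) (\<lambda>p. g2 ` \<theta>1 p)"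
    using w1(1) by (auto simp: valuation_def)
  ultimately have "\<not> valid_in (copy_frame g2 F1) \<phi>"
    using w1(2) by (auto simp: valid_in_def)
  moreover have "copy_frame g2 F1 \<in> C" using C[OF F1(2) g2(1)] .
  moreover have "height (copy_frame g2 F1) \<le> enat h"
    using height_copy_frame[OF F1(1) g2(1) F1(3)] .
  moreover have "finite (worlds (copy_frame g2 F1))" using g2(2) by simp
  ultimately show ?thesis by blast
qed

text \<open>The finite refuting frames live over \<open>'w\<close>; \<open>K\<close> collects
  isomorphic copies of them on natural numbers.\<close>

lemma has_fmpI:
  fixes C :: "'w frame set"
  assumes "\<And>F. F \<in> C \<Longrightarrow> is_frame F"
    and "\<And>F \<phi>. \<lbrakk>F \<in> C; \<not> valid_in F \<phi>\<rbrakk> \<Longrightarrow> \<exists>G\<in>C. finite (worlds G) \<and> \<not> valid_in G \<phi>"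
  shows "has_fmp (Log C)"
proof -
  define K :: "nat frame set" where
    "K = {copy_frame f F | f F. F \<in> C \<and> finite (worlds F) \<and> inj_on f (worlds F)}"
  have "Log C = Log K"
  proof
    show "Log C \<subseteq> Log K"
      using valid_copy_frame assms(1) by (fastforce simp: Log_def K_def)
    show "Log K \<subseteq> Log C"
    proof (rule subsetI, rule ccontr)
      fix \<phi> assume \<phi>: "\<phi> \<in> Log K" "\<phi> \<notin> Log C"
      then obtain G where G: "G \<in> C" "finite (worlds G)" "\<not> valid_in G \<phi>"
        using assms(2) unfolding Log_def by blast
      obtain f :: "'w \<Rightarrow> nat" where f: "inj_on f (worlds G)"
        using finite_imp_inj_to_nat_seg[OF G(2)] by blast
      then have "\<not> valid_in (copy_frame f G) \<phi>" using valid_copy_frame assms(1) G by blast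
      then show False using \<phi>(1) G f by (auto simp: Log_def K_def)
    qed
  qed
  moreover have "\<forall>F\<in>K. is_frame F \<and> finite (worlds F)"
    using assms(1) is_frame_copy_frame by (fastforce simp: K_def)
  ultimately show ?thesis unfolding has_fmp_def by blast
qed

lemma has_fmp_bounded_height:
  fixes C :: "'w frame set"
  assumes "\<And>F. F \<in> C \<Longrightarrow> is_frame F" "p > 0"
    and "\<And>(F :: 'w frame) g. \<lbrakk>F \<in> C; lifting p g F\<rbrakk> \<Longrightarrow> copy_frame g F \<in> C"
  shows "has_fmp (Log {F \<in> C. height F \<le> enat h})" "has_fmp (Log {F \<in> C. height F < \<infinity>})"
proof -
  have *: "\<exists>G\<in>C. height G \<le> enat h \<and> finite (worlds G) \<and> \<not> valid_in G \<phi>"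
    if "F \<in> C" "height F \<le> enat h" "\<not> valid_in F \<phi>" for F \<phi> h
    using finite_refuting_frame[OF assms(1)[OF that(1)] that assms(2,3)] by blast
  show "has_fmp (Log {F \<in> C. height F \<le> enat h})"
    by (rule has_fmpI) (use assms(1) * in blast)+
  show "has_fmp (Log {F \<in> C. height F < \<infinity>})"
  proof (rule has_fmpI)
    fix F \<phi> assume F: "F \<in> {F \<in> C. height F < \<infinity>}" "\<not> valid_in F \<phi>"
    \<comment> \<open>The bound is the height of the refuted frame itself, so the finite frame
      obtained has finite height too.\<close>
    then obtain k where "height F = enat k" by auto
    then obtain G where "G \<in> C" "height G \<le> enat k" "finite (worlds G)" "\<not> valid_in G \<phi>"
      using *[of F k \<phi>] F by auto
    moreover from this have "height G < \<infinity>" by (metis enat_ord_code(4) order_le_less_trans)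
    ultimately show "\<exists>G\<in>{F \<in> C. height F < \<infinity>}. finite (worlds G) \<and> \<not> valid_in G \<phi>" by blast
  qed (use assms(1) in auto)
qed

theorem theorem2:
  fixes m n h :: nat
  assumes "n > m" and "m \<ge> 1" and "h \<ge> 1"
  shows "has_fmp (Log (mn_frames_height m n h :: 'w frame set))
    \<and> has_fmp (Log (mn_frames_finite_height m n :: 'w frame set))
    \<and> has_fmp (Log (m_transitive_frames_height m h :: 'w frame set))
    \<and> has_fmp (Log (m_transitive_frames_finite_height m :: 'w frame set))"
proof -
  have F: "is_frame F" if "F \<in> mn_frames m n" for F :: "'w frame"
    using that by (simp add: mn_frames_def)
  have G: "is_frame F" if "F \<in> m_transitive_frames m" for F :: "'w frame"
    using that by (simp add: m_transitive_frames_def)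
  have "n - m > 0" using assms(1) by simp
  note mn = has_fmp_bounded_height[OF F this mn_frames_copy_frame[OF _ assms(1)]]
    and trans = has_fmp_bounded_height[OF G zero_less_one m_transitive_frames_copy_frame]
  show ?thesis
    unfolding mn_frames_height_def mn_frames_finite_height_def
      m_transitive_frames_height_def m_transitive_frames_finite_height_def
    using mn trans by blast
qed

end
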